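(* Let $A \in \mathbb{R}^{m_1pm_2 \times n_1qn_2}$, $B \in \mathbb{R}^{m_1 \times n_1}$, $C \in \mathbb{R}^{m_2 \times n_2}$, and $\mathcal{S} \subseteq \mathbb{R}^{p \times q}$. If $H \in \mathbb{R}^{p \times q}$ is the unique matrix with $$\operatorname{vec}(H) = \frac{1}{\lVert B \rVert_{\mathsf F}^2 \lVert C \rVert_{\mathsf F}^2} \mathcal{R}(A)^{\mathsf T} \operatorname{vec}(B \otimes C),$$ then any $$X_* \in \operatorname*{argmin}_{X \in \mathcal{S}} \; \lVert X - H \rVert_{\mathsf F}$$ is a solution to $$\min_{X \in \mathcal{S}} \; \lVert A- B \otimes X \otimes C\rVert_{\mathsf F}.$$
   Context: $\otimes$ is the Kronecker product, $\lVert\cdot\rVert_{\mathsf F}$ is the Frobenius norm, and $\operatorname{vec}$ stacks the columns of a matrix into a column vector. The operator $\mathcal{R}:\mathbb{R}^{m_1pm_2 \times n_1qn_2} \to \mathbb{R}^{m_1n_1m_2n_2 \times pq}$ is the unique linear operator satisfying $$\mathcal{R}(Y \otimes X \otimes Z) = \operatorname{vec}(Y \otimes Z) \operatorname{vec}(X)^{\mathsf T}$$ for all $Y \in \mathbb{R}^{m_1 \times n_1}$, $X \in \mathbb{R}^{p \times q}$, $Z \in \mathbb{R}^{m_2 \times n_2}$. *)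

theory Defs
  imports Complex_Main "HOL-Library.FuncSet" "Jordan_Normal_Form.Matrix"
begin

definition kron :: "real mat \<Rightarrow> real mat \<Rightarrow> real mat" (infixl \<open>\<otimes>\<^sub>m\<close> 70) where
  "A \<otimes>\<^sub>m B = mat (dim_row A * dim_row B) (dim_col A * dim_col B)
     (\<lambda>(i, j). A $$ (i div dim_row B, j div dim_col B) * B $$ (i mod dim_row B, j mod dim_col B))"

definition frob_norm :: "real mat \<Rightarrow> real" where
  "frob_norm A = sqrt (\<Sum>i<dim_row A. \<Sum>j<dim_col A. (A $$ (i, j))\<^sup>2)"

text \<open>Column-stacking, as a matrix with one column: entry \<open>(i, j)\<close> of an \<open>m \<times> n\<close> matrix
  goes to position \<open>j * m + i\<close>.\<close>

definition mat_vec :: "real mat \<Rightarrow> real mat" where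
  "mat_vec A = mat (dim_row A * dim_col A) 1 (\<lambda>(k, _). A $$ (k mod dim_row A, k div dim_row A))"

definition linear_on_mat :: "nat \<Rightarrow> nat \<Rightarrow> (real mat \<Rightarrow> real mat) \<Rightarrow> bool" where
  "linear_on_mat m n R \<longleftrightarrow>
     (\<forall>A\<in>carrier_mat m n. \<forall>B\<in>carrier_mat m n. R (A + B) = R A + R B) \<and>
     (\<forall>c. \<forall>A\<in>carrier_mat m n. R (c \<cdot>\<^sub>m A) = c \<cdot>\<^sub>m R A)"

text \<open>The function space is the extensional one (values off the carrier are \<open>undefined\<close>): the type
  \<open>real mat\<close> contains matrices of all dimensions, and otherwise the operator could not be unique.\<close>

definition is_rearrangement ::
    "nat \<Rightarrow> nat \<Rightarrow> nat \<Rightarrow> nat \<Rightarrow> nat \<Rightarrow> nat \<Rightarrow> (real mat \<Rightarrow> real mat) \<Rightarrow> bool" where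
  "is_rearrangement m\<^sub>1 n\<^sub>1 p q m\<^sub>2 n\<^sub>2 R \<longleftrightarrow>
     R \<in> carrier_mat (m\<^sub>1 * p * m\<^sub>2) (n\<^sub>1 * q * n\<^sub>2) \<rightarrow>\<^sub>E carrier_mat (m\<^sub>1 * n\<^sub>1 * m\<^sub>2 * n\<^sub>2) (p * q) \<and>
     linear_on_mat (m\<^sub>1 * p * m\<^sub>2) (n\<^sub>1 * q * n\<^sub>2) R \<and>
     (\<forall>Y\<in>carrier_mat m\<^sub>1 n\<^sub>1. \<forall>X\<in>carrier_mat p q. \<forall>Z\<in>carrier_mat m\<^sub>2 n\<^sub>2.
        R (Y \<otimes>\<^sub>m X \<otimes>\<^sub>m Z) = mat_vec (Y \<otimes>\<^sub>m Z) * transpose_mat (mat_vec X))"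

definition rearrangement ::
    "nat \<Rightarrow> nat \<Rightarrow> nat \<Rightarrow> nat \<Rightarrow> nat \<Rightarrow> nat \<Rightarrow> real mat \<Rightarrow> real mat" where
  "rearrangement m\<^sub>1 n\<^sub>1 p q m\<^sub>2 n\<^sub>2 = (THE R. is_rearrangement m\<^sub>1 n\<^sub>1 p q m\<^sub>2 n\<^sub>2 R)"

lemma kron_carrier [simp, intro]:
  "A \<in> carrier_mat a b \<Longrightarrow> B \<in> carrier_mat c d \<Longrightarrow> A \<otimes>\<^sub>m B \<in> carrier_mat (a * c) (b * d)"
  by (auto simp: kron_def)

lemma index_kron:
  assumes "A \<in> carrier_mat a b" "B \<in> carrier_mat c d" "i < a * c" "j < b * d"
  shows "(A \<otimes>\<^sub>m B) $$ (i, j) = A $$ (i div c, j div d) * B $$ (i mod c, j mod d)"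
  using assms by (auto simp: kron_def)

lemma mix_less: "i < (a::nat) \<Longrightarrow> k < b \<Longrightarrow> i * b + k < a * b"
  by (metis add.commute add_less_cancel_left less_le_trans mult.commute mult_Suc_right
      mult_le_mono2 Suc_leI)

lemma index_kron3:
  assumes "Y \<in> carrier_mat m1 n1" "X \<in> carrier_mat p q" "Z \<in> carrier_mat m2 n2"
    "i < m1" "a < p" "k < m2" "j < n1" "b < q" "l < n2"
  shows "(Y \<otimes>\<^sub>m X \<otimes>\<^sub>m Z) $$ ((i * p + a) * m2 + k, (j * q + b) * n2 + l)
    = Y $$ (i, j) * X $$ (a, b) * Z $$ (k, l)"
proof -
  have 1: "i * p + a < m1 * p" "j * q + b < n1 * q" using assms by (auto intro: mix_less)
  have 2: "(i * p + a) * m2 + k < m1 * p * m2" "(j * q + b) * n2 + l < n1 * q * n2"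
    using 1 assms by (auto intro: mix_less)
  show ?thesis
    using assms 1
    by (simp add: index_kron[OF kron_carrier[OF assms(1,2)] assms(3) 2]
        index_kron[OF assms(1,2)])
qed

lemma linear_on_mat_eqI:
  assumes R: "linear_on_mat m n R" and S: "linear_on_mat m n S"
    and unit: "\<And>i j. i < m \<Longrightarrow> j < n \<Longrightarrow>
      R (mat m n (\<lambda>x. if x = (i, j) then 1 else 0)) = S (mat m n (\<lambda>x. if x = (i, j) then 1 else 0))"
    and R0: "R (0\<^sub>m m n) = S (0\<^sub>m m n)"
    and A: "A \<in> carrier_mat m n"
  shows "R A = S A"
proof -
  have "R (mat m n (\<lambda>x. if x \<in> T then A $$ x else 0)) = S (mat m n (\<lambda>x. if x \<in> T then A $$ x else 0))"
    if "finite T" "T \<subseteq> {..<m} \<times> {..<n}" for T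
    using that
  proof (induction T rule: finite_induct)
    case empty
    have "mat m n (\<lambda>x. 0 :: real) = 0\<^sub>m m n" by (intro eq_matI) auto
    then show ?case using R0 by simp
  next
    case (insert x T)
    obtain i j where x: "x = (i, j)" "i < m" "j < n" using insert by auto
    let ?E = "mat m n (\<lambda>x. if x = (i, j) then 1 else 0)"
    let ?T = "mat m n (\<lambda>x. if x \<in> T then A $$ x else 0)"
    have eq: "mat m n (\<lambda>y. if y \<in> insert x T then A $$ y else 0) = A $$ x \<cdot>\<^sub>m ?E + ?T"
      using x insert.hyps by (intro eq_matI) auto
    have lin: "Q (A $$ x \<cdot>\<^sub>m ?E + ?T) = A $$ x \<cdot>\<^sub>m Q ?E + Q ?T" if "linear_on_mat m n Q" for Q
      using that by (simp add: linear_on_mat_def)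
    show ?case unfolding eq lin[OF R] lin[OF S] using unit[OF x(2,3)] insert by simp
  qed
  from this[of "{..<m} \<times> {..<n}"] have "R (mat m n (\<lambda>x. A $$ x)) = S (mat m n (\<lambda>x. A $$ x))"
    using cong_mat[of m m n n "\<lambda>x. if x \<in> {..<m} \<times> {..<n} then A $$ x else 0" "\<lambda>x. A $$ x"] by simp
  moreover have "mat m n (\<lambda>x. A $$ x) = A" using A by auto
  ultimately show ?thesis by simp
qed

lemma ex1_rearrangement: "\<exists>!R. is_rearrangement m1 n1 p q m2 n2 R"
proof (rule ex_ex1I)
  let ?M = "m1 * p * m2" and ?N = "n1 * q * n2" and ?K = "m1 * n1 * m2 * n2" and ?m = "m1 * m2"
  define f where "f k l = (((k mod ?m) div m2 * p + l mod p) * m2 + (k mod ?m) mod m2,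
    ((k div ?m) div n2 * q + l div p) * n2 + (k div ?m) mod n2)" for k l
  define R where "R = restrict (\<lambda>A :: real mat. mat ?K (p * q) (\<lambda>(k, l). A $$ f k l)) (carrier_mat ?M ?N)"
  have bnd: "(k mod ?m) div m2 < m1" "(k mod ?m) mod m2 < m2" "(k div ?m) div n2 < n1" "(k div ?m) mod n2 < n2"
    "l mod p < p" "l div p < q" "k mod ?m < m1 * m2" "k div ?m < n1 * n2" if "k < ?K" "l < p * q" for k l
  proof -
    have pos: "0 < m2" "0 < n2" "0 < p" "0 < m1" using that by (auto intro!: gr0I)
    show c: "k mod ?m < m1 * m2" using pos by simp
    have "k < (n1 * n2) * ?m" using that by (simp add: ac_simps)
    then show d: "k div ?m < n1 * n2" by (simp add: less_mult_imp_div_less)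
    show "(k mod ?m) div m2 < m1" "(k div ?m) div n2 < n1"
      using c d by (simp_all add: less_mult_imp_div_less)
    show "(k mod ?m) mod m2 < m2" "(k div ?m) mod n2 < n2" "l mod p < p" using pos by auto
    show "l div p < q" using that by (simp add: less_mult_imp_div_less mult.commute)
  qed
  have f: "\<exists>i j. f k l = (i, j) \<and> i < ?M \<and> j < ?N" if "k < ?K" "l < p * q" for k l
    using bnd[OF that] by (auto simp: f_def intro!: mix_less)
  have "R \<in> carrier_mat ?M ?N \<rightarrow>\<^sub>E carrier_mat ?K (p * q)" by (auto simp: R_def)
  moreover have "linear_on_mat ?M ?N R"
    unfolding linear_on_mat_def
  proof (intro conjI ballI allI)
    fix A B :: "real mat" assume "A \<in> carrier_mat ?M ?N" "B \<in> carrier_mat ?M ?N"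
    then show "R (A + B) = R A + R B"
      using f by (intro eq_matI) (fastforce simp: R_def)+
  next
    fix c and A :: "real mat" assume "A \<in> carrier_mat ?M ?N"
    then show "R (c \<cdot>\<^sub>m A) = c \<cdot>\<^sub>m R A"
      using f by (intro eq_matI) (fastforce simp: R_def)+
  qed
  moreover have "R (Y \<otimes>\<^sub>m X \<otimes>\<^sub>m Z) = mat_vec (Y \<otimes>\<^sub>m Z) * transpose_mat (mat_vec X)"
    if Y: "Y \<in> carrier_mat m1 n1" and X: "X \<in> carrier_mat p q" and Z: "Z \<in> carrier_mat m2 n2" for X Y Z
  proof -
    have YZ: "Y \<otimes>\<^sub>m Z \<in> carrier_mat (m1 * m2) (n1 * n2)" using Y Z by auto
    have C: "Y \<otimes>\<^sub>m X \<otimes>\<^sub>m Z \<in> carrier_mat ?M ?N" using X Y Z by auto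
    have K: "m1 * m2 * (n1 * n2) = ?K" by (simp add: ac_simps)
    show ?thesis
    proof (rule eq_matI)
      fix k l assume "k < dim_row (mat_vec (Y \<otimes>\<^sub>m Z) * transpose_mat (mat_vec X))"
        "l < dim_col (mat_vec (Y \<otimes>\<^sub>m Z) * transpose_mat (mat_vec X))"
      then have kl: "k < ?K" "l < p * q" using X YZ K by (auto simp: mat_vec_def)
      note b = bnd[OF kl]
      have "R (Y \<otimes>\<^sub>m X \<otimes>\<^sub>m Z) $$ (k, l) = (Y \<otimes>\<^sub>m X \<otimes>\<^sub>m Z) $$ f k l"
        using kl C by (simp add: R_def)
      also have "\<dots> = Y $$ ((k mod ?m) div m2, (k div ?m) div n2) * X $$ (l mod p, l div p)
          * Z $$ ((k mod ?m) mod m2, (k div ?m) mod n2)"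
        unfolding f_def by (rule index_kron3[OF Y X Z b(1,5,2,3,6,4)])
      also have "\<dots> = (Y \<otimes>\<^sub>m Z) $$ (k mod ?m, k div ?m) * X $$ (l mod p, l div p)"
        by (subst index_kron[OF Y Z b(7,8)]) simp
      also have "\<dots> = (mat_vec (Y \<otimes>\<^sub>m Z) * transpose_mat (mat_vec X)) $$ (k, l)"
        using kl kl(1)[folded K] YZ X by (simp add: mat_vec_def scalar_prod_def)
      finally show "R (Y \<otimes>\<^sub>m X \<otimes>\<^sub>m Z) $$ (k, l) = \<dots>" .
    qed (use X YZ K C in \<open>auto simp: R_def mat_vec_def\<close>)
  qed
  ultimately show "\<exists>R. is_rearrangement m1 n1 p q m2 n2 R"
    unfolding is_rearrangement_def by blast
next
  let ?M = "m1 * p * m2" and ?N = "n1 * q * n2"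
  fix R S assume R: "is_rearrangement m1 n1 p q m2 n2 R" and S: "is_rearrangement m1 n1 p q m2 n2 S"
  have lin: "linear_on_mat ?M ?N R" "linear_on_mat ?M ?N S"
    using R S by (auto simp: is_rearrangement_def)
  have kr: "R (Y \<otimes>\<^sub>m X \<otimes>\<^sub>m Z) = S (Y \<otimes>\<^sub>m X \<otimes>\<^sub>m Z)"
    if "Y \<in> carrier_mat m1 n1" "X \<in> carrier_mat p q" "Z \<in> carrier_mat m2 n2" for Y X Z
    using R S that by (simp add: is_rearrangement_def)
  have "R A = S A" if A: "A \<in> carrier_mat ?M ?N" for A
  proof (rule linear_on_mat_eqI[OF lin _ _ A])
    have "0\<^sub>m m1 n1 \<otimes>\<^sub>m 0\<^sub>m p q \<otimes>\<^sub>m 0\<^sub>m m2 n2 = 0\<^sub>m ?M ?N"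
      by (rule eq_matI) (auto simp: kron_def less_mult_imp_div_less)
    then show "R (0\<^sub>m ?M ?N) = S (0\<^sub>m ?M ?N)" using kr[of "0\<^sub>m m1 n1" "0\<^sub>m p q" "0\<^sub>m m2 n2"] by simp
  next
    fix i j assume ij: "i < ?M" "j < ?N"
    let ?E = "\<lambda>a b m n. mat m n (\<lambda>x. if x = (a, b) then 1 else 0 :: real)"
    let ?Y = "?E (i div m2 div p) (j div n2 div q) m1 n1"
    let ?X = "?E (i div m2 mod p) (j div n2 mod q) p q"
    let ?Z = "?E (i mod m2) (j mod n2) m2 n2"
    have C: "?Y \<in> carrier_mat m1 n1" "?X \<in> carrier_mat p q" "?Z \<in> carrier_mat m2 n2" by auto
    have "?Y \<otimes>\<^sub>m ?X \<otimes>\<^sub>m ?Z = ?E i j ?M ?N"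
    proof (rule eq_matI)
      fix u v assume "u < dim_row (?E i j ?M ?N)" "v < dim_col (?E i j ?M ?N)"
      then have uv: "u < ?M" "v < ?N" by auto
      then have pos: "0 < m2" "0 < n2" "0 < p" "0 < q" by (auto intro!: gr0I)
      have d: "u div m2 < m1 * p" "v div n2 < n1 * q" using uv by (auto simp: less_mult_imp_div_less)
      have dd: "u div m2 div p < m1" "v div n2 div q < n1" using d by (auto simp: less_mult_imp_div_less)
      have e: "(u div m2 div p = i div m2 div p \<and> u div m2 mod p = i div m2 mod p \<and> u mod m2 = i mod m2) = (u = i)"
        "(v div n2 div q = j div n2 div q \<and> v div n2 mod q = j div n2 mod q \<and> v mod n2 = j mod n2) = (v = j)"
        by (metis div_mult_mod_eq)+
      show "(?Y \<otimes>\<^sub>m ?X \<otimes>\<^sub>m ?Z) $$ (u, v) = ?E i j ?M ?N $$ (u, v)"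
        using uv pos dd e
        by (subst index_kron[OF kron_carrier[OF C(1,2)] C(3) uv], subst index_kron[OF C(1,2) d]) auto
    qed (auto simp: kron_def)
    then show "R (?E i j ?M ?N) = S (?E i j ?M ?N)" using kr[OF C] by simp
  qed
  then show "R = S" using R S
    by (intro extensionalityI[of R "carrier_mat ?M ?N"]) (auto simp: is_rearrangement_def PiE_def)
qed

lemma rearrangement: "is_rearrangement m1 n1 p q m2 n2 (rearrangement m1 n1 p q m2 n2)"
  unfolding rearrangement_def by (rule theI'[OF ex1_rearrangement])

end

theory Submission
  imports Defs
begin

text \<open>Both objectives are squared distances for the Frobenius inner product, and the rearrangement
  \<open>\<R>\<close> translates one into the other because it preserves this inner product. On Kronecker products
  that is immediate, since \<open>\<langle>A \<otimes> B, A' \<otimes> B'\<rangle> = \<langle>A, A'\<rangle> \<langle>B, B'\<rangle>\<close>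
  (\<open>mat_inner_kron\<close>), \<open>vec\<close> is an isometry and the rank-one matrix \<open>v w\<^sup>T\<close> is the
  Kronecker product \<open>v \<otimes> w\<^sup>T\<close>; it extends to all matrices because the products
  \<open>Y \<otimes> X \<otimes> Z\<close> span (\<open>linear_on_mat_kron_eqI\<close>).

  Hence \<open>\<langle>A, B \<otimes> X \<otimes> C\<rangle> = \<langle>\<R>(A), vec(B \<otimes> C) vec(X)\<^sup>T\<rangle> =
  \<langle>\<R>(A)\<^sup>T vec(B \<otimes> C), vec(X)\<rangle>\<close>, which with \<open>\<beta> = \<parallel>B\<parallel>\<^sup>2 \<parallel>C\<parallel>\<^sup>2\<close> is \<open>\<beta> \<langle>H, X\<rangle>\<close> by the choice of \<open>H\<close>.
  As \<open>\<parallel>B \<otimes> X \<otimes> C\<parallel>\<^sup>2 = \<beta> \<parallel>X\<parallel>\<^sup>2\<close>, completing the square gives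
  \<open>\<parallel>A - B \<otimes> X \<otimes> C\<parallel>\<^sup>2 = \<beta> \<parallel>X - H\<parallel>\<^sup>2 + (\<parallel>A\<parallel>\<^sup>2 - \<beta> \<parallel>H\<parallel>\<^sup>2)\<close>:
  the second objective is a nondecreasing function of the first. When \<open>\<beta> = 0\<close> it is constant,
  so the claim survives the convention \<open>1 / 0 = 0\<close> in the formula for \<open>H\<close>.\<close>

section \<open>The Frobenius inner product\<close>

definition mat_inner :: "real mat \<Rightarrow> real mat \<Rightarrow> real" where
  "mat_inner A B = (\<Sum>i<dim_row A. \<Sum>j<dim_col A. A $$ (i, j) * B $$ (i, j))"

lemma mat_inner_carrier:
  "A \<in> carrier_mat m n \<Longrightarrow> mat_inner A B = (\<Sum>i<m. \<Sum>j<n. A $$ (i, j) * B $$ (i, j))"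
  by (auto simp: mat_inner_def)

lemma mat_inner_commute:
  "A \<in> carrier_mat m n \<Longrightarrow> B \<in> carrier_mat m n \<Longrightarrow> mat_inner A B = mat_inner B A"
  by (simp add: mat_inner_carrier mult.commute)

lemma mat_inner_add_left:
  assumes "A \<in> carrier_mat m n" "B \<in> carrier_mat m n"
  shows "mat_inner (A + B) D = mat_inner A D + mat_inner B D"
  using assms by (simp add: mat_inner_carrier[of _ m n] algebra_simps sum.distrib)

lemma mat_inner_smult_left:
  assumes "A \<in> carrier_mat m n"
  shows "mat_inner (c \<cdot>\<^sub>m A) D = c * mat_inner A D"
  using assms by (simp add: mat_inner_carrier[of _ m n] algebra_simps sum_distrib_left)

lemma frob_norm_nonneg: "0 \<le> frob_norm A"
  by (simp add: frob_norm_def sum_nonneg)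

lemma frob_norm_square: "(frob_norm A)\<^sup>2 = mat_inner A A"
  by (simp add: frob_norm_def mat_inner_def sum_nonneg power2_eq_square)

lemma mat_inner_diff_diff:
  assumes "A \<in> carrier_mat m n" "B \<in> carrier_mat m n"
  shows "mat_inner (A - B) (A - B) = mat_inner A A - 2 * mat_inner A B + mat_inner B B"
  using assms
  by (simp add: mat_inner_carrier[OF minus_carrier_mat[OF assms(2)]] mat_inner_carrier[of _ m n]
      algebra_simps sum.distrib sum_subtractf sum_distrib_left)

lemma mat_inner_null_right:
  assumes "A \<in> carrier_mat m n" "B \<in> carrier_mat m n" and null: "mat_inner B B = 0"
  shows "mat_inner A B = 0"
proof -
  have "B $$ (i, j) = 0" if "i < m" "j < n" for i j
    using null that assms(2)
    by (simp add: mat_inner_carrier sum_nonneg_eq_0_iff sum_nonneg)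
  then show ?thesis using assms(1) by (simp add: mat_inner_carrier)
qed

text \<open>The rule \<open>\<langle>A\<^sup>T B, D\<rangle> = tr (B\<^sup>T A D) = \<langle>A, B D\<^sup>T\<rangle>\<close>: multiplication by \<open>A\<^sup>T\<close> on one side
  trades for a rank-one matrix on the other when \<open>B\<close> and \<open>D\<close> are columns.\<close>

lemma mat_inner_transpose_mult:
  assumes A: "A \<in> carrier_mat k m" and B: "B \<in> carrier_mat k n" and D: "D \<in> carrier_mat m n"
  shows "mat_inner (transpose_mat A * B) D = mat_inner A (B * transpose_mat D)"
proof -
  have "mat_inner (transpose_mat A * B) D
      = (\<Sum>i<m. \<Sum>j<n. \<Sum>l<k. A $$ (l, i) * B $$ (l, j) * D $$ (i, j))"
    using assms
    by (simp add: mat_inner_carrier[of _ m n] scalar_prod_def sum_distrib_right atLeast0LessThan)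
  also have "\<dots> = (\<Sum>i<m. \<Sum>l<k. \<Sum>j<n. A $$ (l, i) * B $$ (l, j) * D $$ (i, j))"
    by (intro sum.cong refl sum.swap)
  also have "\<dots> = (\<Sum>l<k. \<Sum>i<m. \<Sum>j<n. A $$ (l, i) * B $$ (l, j) * D $$ (i, j))"
    by (rule sum.swap)
  also have "\<dots> = mat_inner A (B * transpose_mat D)"
    using assms
    by (simp add: mat_inner_carrier[of _ k m] scalar_prod_def sum_distrib_left atLeast0LessThan
        mult.assoc)
  finally show ?thesis .
qed

section \<open>Kronecker products and vectorization\<close>

text \<open>Kronecker products and \<open>vec\<close> both encode a pair of indices as quotient and remainder, so their
  sums unfold into double sums.\<close>

lemma sum_div_mod:
  fixes f :: "nat \<Rightarrow> nat \<Rightarrow> 'a::comm_monoid_add"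
  shows "(\<Sum>k<a * c. f (k div c) (k mod c)) = (\<Sum>i<a. \<Sum>j<c. f i j)"
proof -
  have "(\<Sum>k<a * c. f (k div c) (k mod c)) = (\<Sum>i<a. \<Sum>k=i * c..<i * c + c. f (k div c) (k mod c))"
    by (rule sum.nat_group[symmetric])
  also have "\<dots> = (\<Sum>i<a. \<Sum>j<c. f i j)"
  proof (rule sum.cong[OF refl])
    fix i
    have "(\<Sum>k=i * c..<i * c + c. f (k div c) (k mod c))
        = (\<Sum>j=0..<c. f ((j + i * c) div c) ((j + i * c) mod c))"
      using sum.shift_bounds_nat_ivl[of "\<lambda>k. f (k div c) (k mod c)" 0 "i * c" c]
      by (simp add: add.commute)
    then show "(\<Sum>k=i * c..<i * c + c. f (k div c) (k mod c)) = (\<Sum>j<c. f i j)"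
      by (simp add: atLeast0LessThan)
  qed
  finally show ?thesis .
qed

lemma mat_vec_carrier [simp, intro]: "A \<in> carrier_mat m n \<Longrightarrow> mat_vec A \<in> carrier_mat (m * n) 1"
  by (auto simp: mat_vec_def)

lemma mat_inner_mat_vec:
  assumes A: "A \<in> carrier_mat m n" and B: "B \<in> carrier_mat m n"
  shows "mat_inner (mat_vec A) (mat_vec B) = mat_inner A B"
proof -
  have "mat_inner (mat_vec A) (mat_vec B)
      = (\<Sum>k<n * m. A $$ (k mod m, k div m) * B $$ (k mod m, k div m))"
    using A B
    by (simp add: mat_inner_carrier[OF mat_vec_carrier[OF A]] mult.commute[of n m])
      (simp add: mat_vec_def)
  also have "\<dots> = (\<Sum>j<n. \<Sum>i<m. A $$ (i, j) * B $$ (i, j))"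
    by (rule sum_div_mod)
  also have "\<dots> = mat_inner A B"
    unfolding mat_inner_carrier[OF A] by (rule sum.swap)
  finally show ?thesis .
qed

lemma mat_inner_kron:
  assumes A: "A \<in> carrier_mat a b" "A' \<in> carrier_mat a b"
    and B: "B \<in> carrier_mat c d" "B' \<in> carrier_mat c d"
  shows "mat_inner (A \<otimes>\<^sub>m B) (A' \<otimes>\<^sub>m B') = mat_inner A A' * mat_inner B B'"
proof -
  let ?F = "\<lambda>i j. A $$ (i, j) * A' $$ (i, j)" and ?G = "\<lambda>k l. B $$ (k, l) * B' $$ (k, l)"
  have "mat_inner (A \<otimes>\<^sub>m B) (A' \<otimes>\<^sub>m B')
      = (\<Sum>i<a * c. \<Sum>j<b * d. ?F (i div c) (j div d) * ?G (i mod c) (j mod d))"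
    by (simp add: mat_inner_carrier[OF kron_carrier[OF A(1) B(1)]]
        index_kron[OF A(1) B(1)] index_kron[OF A(2) B(2)] mult.assoc mult.left_commute)
  also have "\<dots> = (\<Sum>i<a * c. \<Sum>j<b. \<Sum>l<d. ?F (i div c) j * ?G (i mod c) l)"
    by (intro sum.cong refl sum_div_mod)
  also have "\<dots> = (\<Sum>i<a. \<Sum>k<c. \<Sum>j<b. \<Sum>l<d. ?F i j * ?G k l)"
    by (rule sum_div_mod)
  also have "\<dots> = (\<Sum>i<a. \<Sum>k<c. (\<Sum>j<b. ?F i j) * (\<Sum>l<d. ?G k l))"
    by (simp only: sum_product)
  also have "\<dots> = mat_inner A A' * mat_inner B B'"
    unfolding mat_inner_carrier[OF A(1)] mat_inner_carrier[OF B(1)] by (simp only: sum_product)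
  finally show ?thesis .
qed

lemma mat_inner_kron3:
  assumes "Y \<in> carrier_mat m1 n1" "Y' \<in> carrier_mat m1 n1"
    and "X \<in> carrier_mat p q" "X' \<in> carrier_mat p q"
    and "Z \<in> carrier_mat m2 n2" "Z' \<in> carrier_mat m2 n2"
  shows "mat_inner (Y \<otimes>\<^sub>m X \<otimes>\<^sub>m Z) (Y' \<otimes>\<^sub>m X' \<otimes>\<^sub>m Z')
    = mat_inner Y Y' * mat_inner X X' * mat_inner Z Z'"
  using assms mat_inner_kron[of "Y \<otimes>\<^sub>m X" "m1 * p" "n1 * q" "Y' \<otimes>\<^sub>m X'" Z m2 n2 Z']
  by (simp add: mat_inner_kron[of Y m1 n1 Y' X p q X'] kron_carrier)

text \<open>A column times a row is the Kronecker product of the two, so this is multiplicativity of the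
  inner product again.\<close>

lemma mat_inner_outer:
  assumes v: "v \<in> carrier_mat k 1" "v' \<in> carrier_mat k 1"
    and w: "w \<in> carrier_mat l 1" "w' \<in> carrier_mat l 1"
  shows "mat_inner (v * transpose_mat w) (v' * transpose_mat w') = mat_inner v v' * mat_inner w w'"
proof -
  have outer: "x * transpose_mat y = x \<otimes>\<^sub>m transpose_mat y"
    if "x \<in> carrier_mat k 1" "y \<in> carrier_mat l 1" for x y :: "real mat"
    using that by (intro eq_matI) (auto simp: kron_def scalar_prod_def)
  have "mat_inner (transpose_mat w) (transpose_mat w') = mat_inner w w'"
    using w by (simp add: mat_inner_carrier[of _ 1 l] mat_inner_carrier[of _ l 1])
  then show ?thesis
    unfolding outer[OF v(1) w(1)] outer[OF v(2) w(2)]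
    using mat_inner_kron[OF v, of "transpose_mat w" 1 l "transpose_mat w'"] w by simp
qed

section \<open>Kronecker products span\<close>

lemma kron_unit:
  assumes "i < a * c" "j < b * d"
  shows "mat (a * c) (b * d) (\<lambda>x. if x = (i, j) then 1 else 0 :: real)
    = mat a b (\<lambda>x. if x = (i div c, j div d) then 1 else 0)
      \<otimes>\<^sub>m mat c d (\<lambda>x. if x = (i mod c, j mod d) then 1 else 0)"
proof (rule eq_matI)
  let ?A = "mat a b (\<lambda>x. if x = (i div c, j div d) then 1 else 0 :: real)"
  let ?B = "mat c d (\<lambda>x. if x = (i mod c, j mod d) then 1 else 0 :: real)"
  fix u v assume "u < dim_row (?A \<otimes>\<^sub>m ?B)" "v < dim_col (?A \<otimes>\<^sub>m ?B)"
  then have uv: "u < a * c" "v < b * d" by (auto simp: kron_def)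
  then have "0 < c" "0 < d" by (auto intro!: gr0I)
  moreover have "u div c < a" "v div d < b" using uv by (auto simp: less_mult_imp_div_less)
  moreover have "(u div c = i div c \<and> u mod c = i mod c) = (u = i)"
    "(v div d = j div d \<and> v mod d = j mod d) = (v = j)"
    by (metis div_mult_mod_eq)+
  ultimately show "mat (a * c) (b * d) (\<lambda>x. if x = (i, j) then 1 else 0 :: real) $$ (u, v)
      = (?A \<otimes>\<^sub>m ?B) $$ (u, v)"
    using uv by (subst index_kron[of ?A a b ?B c d]) auto
qed (auto simp: kron_def)

text \<open>Every matrix unit is a triple Kronecker product of matrix units, so the triple products
  contain a basis.\<close>

lemma linear_on_mat_kron_eqI:
  assumes lin: "linear_on_mat (m1 * p * m2) (n1 * q * n2) R"
      "linear_on_mat (m1 * p * m2) (n1 * q * n2) S"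
    and kron: "\<And>Y X Z. Y \<in> carrier_mat m1 n1 \<Longrightarrow> X \<in> carrier_mat p q \<Longrightarrow> Z \<in> carrier_mat m2 n2
      \<Longrightarrow> R (Y \<otimes>\<^sub>m X \<otimes>\<^sub>m Z) = S (Y \<otimes>\<^sub>m X \<otimes>\<^sub>m Z)"
    and A: "A \<in> carrier_mat (m1 * p * m2) (n1 * q * n2)"
  shows "R A = S A"
proof (rule linear_on_mat_eqI[OF lin _ _ A])
  fix i j assume ij: "i < m1 * p * m2" "j < n1 * q * n2"
  then have "i div m2 < m1 * p" "j div n2 < n1 * q" by (auto simp: less_mult_imp_div_less)
  then show "R (mat (m1 * p * m2) (n1 * q * n2) (\<lambda>x. if x = (i, j) then 1 else 0))
      = S (mat (m1 * p * m2) (n1 * q * n2) (\<lambda>x. if x = (i, j) then 1 else 0))"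
    unfolding kron_unit[OF ij] by (subst (1 2) kron_unit) (auto intro!: kron)
next
  have "0\<^sub>m m1 n1 \<otimes>\<^sub>m 0\<^sub>m p q \<otimes>\<^sub>m 0\<^sub>m m2 n2 = 0\<^sub>m (m1 * p * m2) (n1 * q * n2)"
    by (rule eq_matI) (auto simp: kron_def less_mult_imp_div_less)
  then show "R (0\<^sub>m (m1 * p * m2) (n1 * q * n2)) = S (0\<^sub>m (m1 * p * m2) (n1 * q * n2))"
    using kron[of "0\<^sub>m m1 n1" "0\<^sub>m p q" "0\<^sub>m m2 n2"] by simp
qed

section \<open>The rearrangement preserves the inner product\<close>

text \<open>Against a Kronecker product both sides are linear in \<open>A\<close>, so \<open>A\<close> may be taken to be a
  Kronecker product too; there both sides equal
  \<open>\<langle>Y', Y\<rangle> \<langle>X', X\<rangle> \<langle>Z', Z\<rangle>\<close>.\<close>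

lemma mat_inner_rearrangement_kron:
  assumes A: "A \<in> carrier_mat (m1 * p * m2) (n1 * q * n2)"
    and Y: "Y \<in> carrier_mat m1 n1" and X: "X \<in> carrier_mat p q" and Z: "Z \<in> carrier_mat m2 n2"
  shows "mat_inner (rearrangement m1 n1 p q m2 n2 A) (mat_vec (Y \<otimes>\<^sub>m Z) * transpose_mat (mat_vec X))
    = mat_inner A (Y \<otimes>\<^sub>m X \<otimes>\<^sub>m Z)"
proof -
  let ?M = "m1 * p * m2" and ?N = "n1 * q * n2"
  define R where "R = rearrangement m1 n1 p q m2 n2"
  define V where "V = mat_vec (Y \<otimes>\<^sub>m Z) * transpose_mat (mat_vec X)"
  have rearr: "is_rearrangement m1 n1 p q m2 n2 R"
    unfolding R_def by (rule rearrangement)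
  have R_carrier: "R D \<in> carrier_mat (m1 * n1 * m2 * n2) (p * q)" if "D \<in> carrier_mat ?M ?N" for D
    using rearr that by (auto simp: is_rearrangement_def)
  have R_add: "R (D + E) = R D + R E" if "D \<in> carrier_mat ?M ?N" "E \<in> carrier_mat ?M ?N" for D E
    using rearr that by (simp add: is_rearrangement_def linear_on_mat_def)
  have R_smult: "R (c \<cdot>\<^sub>m D) = c \<cdot>\<^sub>m R D" if "D \<in> carrier_mat ?M ?N" for c D
    using rearr that by (simp add: is_rearrangement_def linear_on_mat_def)
  \<comment> \<open>Linearity is a notion for matrix-valued maps, so scalars appear as \<open>1 \<times> 1\<close> matrices.\<close>
  have "mat 1 1 (\<lambda>_. mat_inner (R A) V) = mat 1 1 (\<lambda>_. mat_inner A (Y \<otimes>\<^sub>m X \<otimes>\<^sub>m Z))"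
  proof (rule linear_on_mat_kron_eqI[OF _ _ _ A])
    show "linear_on_mat ?M ?N (\<lambda>D. mat 1 1 (\<lambda>_. mat_inner (R D) V))"
      unfolding linear_on_mat_def
      by (auto simp: R_add R_smult mat_inner_add_left[OF R_carrier R_carrier]
          mat_inner_smult_left[OF R_carrier] intro!: eq_matI)
    show "linear_on_mat ?M ?N (\<lambda>D. mat 1 1 (\<lambda>_. mat_inner D (Y \<otimes>\<^sub>m X \<otimes>\<^sub>m Z)))"
      unfolding linear_on_mat_def
      by (auto simp: mat_inner_add_left mat_inner_smult_left intro!: eq_matI)
  next
    fix Y' X' Z' :: "real mat"
    assume C: "Y' \<in> carrier_mat m1 n1" "X' \<in> carrier_mat p q" "Z' \<in> carrier_mat m2 n2"
    have "R (Y' \<otimes>\<^sub>m X' \<otimes>\<^sub>m Z') = mat_vec (Y' \<otimes>\<^sub>m Z') * transpose_mat (mat_vec X')"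
      using rearr C by (simp add: is_rearrangement_def)
    then have "mat_inner (R (Y' \<otimes>\<^sub>m X' \<otimes>\<^sub>m Z')) V
        = mat_inner (mat_vec (Y' \<otimes>\<^sub>m Z')) (mat_vec (Y \<otimes>\<^sub>m Z)) * mat_inner (mat_vec X') (mat_vec X)"
      unfolding V_def using C X Y Z
      by (simp add: mat_inner_outer[OF mat_vec_carrier[OF kron_carrier]
            mat_vec_carrier[OF kron_carrier] mat_vec_carrier mat_vec_carrier])
    also have "\<dots> = mat_inner Y' Y * mat_inner Z' Z * mat_inner X' X"
      using C X Y Z
      by (simp add: mat_inner_mat_vec[OF kron_carrier kron_carrier] mat_inner_mat_vec[of _ p q]
          mat_inner_kron)
    also have "\<dots> = mat_inner (Y' \<otimes>\<^sub>m X' \<otimes>\<^sub>m Z') (Y \<otimes>\<^sub>m X \<otimes>\<^sub>m Z)"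
      using C X Y Z by (simp add: mat_inner_kron3)
    finally show "mat 1 1 (\<lambda>_. mat_inner (R (Y' \<otimes>\<^sub>m X' \<otimes>\<^sub>m Z')) V)
        = mat 1 1 (\<lambda>_. mat_inner (Y' \<otimes>\<^sub>m X' \<otimes>\<^sub>m Z') (Y \<otimes>\<^sub>m X \<otimes>\<^sub>m Z))" by simp
  qed
  from arg_cong[OF this, of "\<lambda>D. D $$ (0, 0)"] show ?thesis by (simp add: R_def V_def)
qed

section \<open>Reduction of the approximation problem\<close>

text \<open>Completing the square: \<open>H\<close> minimizes the error over all \<open>p \<times> q\<close> matrices, and
  the squared error exceeds its minimum by a multiple of the squared distance to \<open>H\<close>.\<close>

lemma frob_norm_kron_approx_square:
  assumes A: "A \<in> carrier_mat (m1 * p * m2) (n1 * q * n2)"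
    and B: "B \<in> carrier_mat m1 n1" and C: "C \<in> carrier_mat m2 n2"
    and H: "H \<in> carrier_mat p q" and X: "X \<in> carrier_mat p q"
    and vec_H: "mat_vec H = (1 / ((frob_norm B)\<^sup>2 * (frob_norm C)\<^sup>2)) \<cdot>\<^sub>m
           (transpose_mat (rearrangement m1 n1 p q m2 n2 A) * mat_vec (B \<otimes>\<^sub>m C))"
  shows "(frob_norm (A - B \<otimes>\<^sub>m X \<otimes>\<^sub>m C))\<^sup>2
    = (frob_norm B)\<^sup>2 * (frob_norm C)\<^sup>2 * (frob_norm (X - H))\<^sup>2
      + ((frob_norm A)\<^sup>2 - (frob_norm B)\<^sup>2 * (frob_norm C)\<^sup>2 * (frob_norm H)\<^sup>2)"
proof -
  define \<beta> where "\<beta> = (frob_norm B)\<^sup>2 * (frob_norm C)\<^sup>2"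
  have W: "B \<otimes>\<^sub>m X \<otimes>\<^sub>m C \<in> carrier_mat (m1 * p * m2) (n1 * q * n2)"
    using B X C by auto
  have W_norm: "mat_inner (B \<otimes>\<^sub>m X \<otimes>\<^sub>m C) (B \<otimes>\<^sub>m X \<otimes>\<^sub>m C) = \<beta> * mat_inner X X"
    using B X C by (simp add: mat_inner_kron3 \<beta>_def frob_norm_square)
  have cross: "mat_inner A (B \<otimes>\<^sub>m X \<otimes>\<^sub>m C) = \<beta> * mat_inner X H"
  proof (cases "\<beta> = 0")
    \<comment> \<open>Here the formula for \<open>H\<close> says nothing about \<open>A\<close>, but \<open>B \<otimes> X \<otimes> C\<close> vanishes.\<close>
    case True
    then show ?thesis using mat_inner_null_right[OF A W] W_norm by simp
  next
    case False
    let ?R = "rearrangement m1 n1 p q m2 n2 A" and ?v = "mat_vec (B \<otimes>\<^sub>m C)"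
    have "?R \<in> carrier_mat (m1 * n1 * m2 * n2) (p * q)"
      using rearrangement[of m1 n1 p q m2 n2] A by (auto simp: is_rearrangement_def)
    moreover have "?v \<in> carrier_mat (m1 * n1 * m2 * n2) 1"
      using mat_vec_carrier[OF kron_carrier[OF B C]] by (simp add: ac_simps)
    ultimately have RTv: "transpose_mat ?R * ?v \<in> carrier_mat (p * q) 1"
      and adj: "mat_inner (transpose_mat ?R * ?v) (mat_vec X)
        = mat_inner ?R (?v * transpose_mat (mat_vec X))"
      using mat_inner_transpose_mult[OF _ _ mat_vec_carrier[OF X]] by auto
    have "mat_inner H X = mat_inner (mat_vec H) (mat_vec X)"
      using mat_inner_mat_vec[OF H X] by simp
    also have "\<dots> = 1 / \<beta> * mat_inner (transpose_mat ?R * ?v) (mat_vec X)"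
      unfolding vec_H \<beta>_def by (rule mat_inner_smult_left[OF RTv])
    also have "\<dots> = 1 / \<beta> * mat_inner A (B \<otimes>\<^sub>m X \<otimes>\<^sub>m C)"
      unfolding adj mat_inner_rearrangement_kron[OF A B X C] ..
    finally show ?thesis using False mat_inner_commute[OF H X] by simp
  qed
  show ?thesis
    unfolding \<beta>_def[symmetric] unfolding frob_norm_square mat_inner_diff_diff[OF A W]
      mat_inner_diff_diff[OF X H] W_norm cross
    by (simp add: algebra_simps)
qed

theorem proposition3p3:
  fixes m\<^sub>1 n\<^sub>1 p q m\<^sub>2 n\<^sub>2 :: nat
    and A B C H X0 :: "real mat"
    and S :: "real mat set"
  assumes "A \<in> carrier_mat (m\<^sub>1 * p * m\<^sub>2) (n\<^sub>1 * q * n\<^sub>2)"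
    and "B \<in> carrier_mat m\<^sub>1 n\<^sub>1"
    and "C \<in> carrier_mat m\<^sub>2 n\<^sub>2"
    and "S \<subseteq> carrier_mat p q"
    and "H \<in> carrier_mat p q"
    and "mat_vec H = (1 / ((frob_norm B)\<^sup>2 * (frob_norm C)\<^sup>2)) \<cdot>\<^sub>m
           (transpose_mat (rearrangement m\<^sub>1 n\<^sub>1 p q m\<^sub>2 n\<^sub>2 A) * mat_vec (B \<otimes>\<^sub>m C))"
    and "is_arg_min (\<lambda>X. frob_norm (X - H)) (\<lambda>X. X \<in> S) X0"
  shows "is_arg_min (\<lambda>X. frob_norm (A - B \<otimes>\<^sub>m X \<otimes>\<^sub>m C)) (\<lambda>X. X \<in> S) X0"
proof -
  have X0: "X0 \<in> S"
    and min: "\<And>X. X \<in> S \<Longrightarrow> frob_norm (X0 - H) \<le> frob_norm (X - H)"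
    using assms(7) by (auto simp: is_arg_min_linorder)
  have "frob_norm (A - B \<otimes>\<^sub>m X0 \<otimes>\<^sub>m C) \<le> frob_norm (A - B \<otimes>\<^sub>m X \<otimes>\<^sub>m C)" if X: "X \<in> S" for X
  proof (rule power2_le_imp_le[OF _ frob_norm_nonneg])
    have "X0 \<in> carrier_mat p q" "X \<in> carrier_mat p q"
      using X0 X assms(4) by auto
    note sq = this[THEN frob_norm_kron_approx_square[OF assms(1-3,5) _ assms(6)]]
    have "(frob_norm (X0 - H))\<^sup>2 \<le> (frob_norm (X - H))\<^sup>2"
      using min[OF X] frob_norm_nonneg by (rule power_mono)
    then show "(frob_norm (A - B \<otimes>\<^sub>m X0 \<otimes>\<^sub>m C))\<^sup>2 \<le> (frob_norm (A - B \<otimes>\<^sub>m X \<otimes>\<^sub>m C))\<^sup>2"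
      unfolding sq by (simp add: mult_left_mono)
  qed
  with X0 show ?thesis by (simp add: is_arg_min_linorder)
qed

end
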